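(* Let $b\geq 2$ and $p\geq 2$ be natural numbers, and define $\phi_p:\mathbb{N}\to\mathbb{N}$ by $\phi_p(n)=(S_b(n))^p$. Then the set of natural numbers $n$ with $\phi_p(n)=n$ is finite. Moreover, if $\phi_p(n)=n$, then $n\leq b^{p^2}$.
   Context: For a natural number $n=\sum_{i=0}^{m-1}a_ib^i$ written in base $b$ (digits $0\le a_i\le b-1$), $S_b(n)=\sum_{i=0}^{m-1}a_i$ is its base-$b$ digit sum. *)

theory Defs
  imports Main
begin

definition digit_sum :: "nat \<Rightarrow> nat \<Rightarrow> nat" where
  "digit_sum b n = (\<Sum>i | b ^ i \<le> n. n div b ^ i mod b)"

definition phi :: "nat \<Rightarrow> nat \<Rightarrow> nat \<Rightarrow> nat" where
  "phi b p n = digit_sum b n ^ p"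

text \<open>For \<open>b \<ge> 2\<close>, \<^const>\<open>digit_sum\<close> agrees with the sum of the digits
  of any base-\<open>b\<close> expansion (leading zeros allowed).\<close>

lemma expansion_less:
  fixes a :: "nat \<Rightarrow> nat"
  assumes "\<And>i. i < m \<Longrightarrow> a i < b"
  shows "(\<Sum>i<m. a i * b ^ i) < b ^ m"
  using assms
proof (induction m)
  case (Suc m)
  have "(\<Sum>i<m. a i * b ^ i) < b ^ m" using Suc by simp
  moreover have "Suc (a m) * b ^ m \<le> b * b ^ m"
    using Suc.prems[of m] by (intro mult_right_mono) auto
  ultimately show ?case by simp
qed simp

lemma expansion_digit:
  fixes a :: "nat \<Rightarrow> nat"
  assumes "\<And>i. i < m \<Longrightarrow> a i < b" and "j < m"
  shows "(\<Sum>i<m. a i * b ^ i) div b ^ j mod b = a j"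
  using assms
proof (induction j arbitrary: a m)
  case 0
  then obtain k where m: "m = Suc k" by (cases m) auto
  have "(\<Sum>i<m. a i * b ^ i) = a 0 + b * (\<Sum>i<k. a (Suc i) * b ^ i)"
    unfolding m sum.lessThan_Suc_shift by (simp add: sum_distrib_left mult_ac)
  then show ?case using 0 by simp
next
  case (Suc j)
  then obtain k where m: "m = Suc k" by (cases m) auto
  have "(\<Sum>i<m. a i * b ^ i) = a 0 + b * (\<Sum>i<k. a (Suc i) * b ^ i)"
    unfolding m sum.lessThan_Suc_shift by (simp add: sum_distrib_left mult_ac)
  moreover have "a 0 < b" using Suc.prems by simp
  ultimately have "(\<Sum>i<m. a i * b ^ i) div b = (\<Sum>i<k. a (Suc i) * b ^ i)"
    by simp
  moreover have "(\<Sum>i<k. a (Suc i) * b ^ i) div b ^ j mod b = a (Suc j)"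
    using Suc.prems m by (intro Suc.IH) auto
  ultimately show ?case by (simp add: div_mult2_eq)
qed

lemma digit_sum_expansion:
  fixes a :: "nat \<Rightarrow> nat"
  assumes b: "b \<ge> 2" and a: "\<And>i. i < m \<Longrightarrow> a i < b"
  shows "digit_sum b (\<Sum>i<m. a i * b ^ i) = (\<Sum>i<m. a i)"
proof -
  define n where "n = (\<Sum>i<m. a i * b ^ i)"
  have "n < b ^ m" unfolding n_def using a by (rule expansion_less)
  have "i < m" if "b ^ i \<le> n" for i
  proof -
    have "b ^ i < b ^ m" using that \<open>n < b ^ m\<close> by simp
    then show ?thesis using b by (simp add: power_strict_increasing_iff)
  qed
  then have "(\<Sum>i | b ^ i \<le> n. n div b ^ i mod b) = (\<Sum>i<m. n div b ^ i mod b)"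
    by (intro sum.mono_neutral_left) auto
  also have "\<dots> = (\<Sum>i<m. a i)"
    by (rule sum.cong) (simp_all add: n_def expansion_digit a)
  finally show ?thesis by (simp add: digit_sum_def n_def)
qed

end

(* If n = S_b(n)^p has k + 1 digits, then b^k <= n <= ((k + 1) (b - 1))^p.  The left-hand side
   outgrows the right-hand side, and it is already larger at k = p^2 unless (b, p) is one of
   (2, 2), (2, 3), (2, 4), (3, 2).  In these four cases it is larger at k = 6, 11, 17, 5, and
   the few perfect powers in between are checked by computing their digit sums. *)
theory Submission imports Defs
begin

text \<open>Leading zeros contribute nothing, so the index set that varies with \<open>n\<close> can
  be replaced by a fixed range. This allows termwise bounds and the evaluation of concrete digit
  sums.\<close>

lemma digit_sum_eq_sum:
  assumes "b \<ge> 2" and "n < b ^ m"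
  shows "digit_sum b n = (\<Sum>i<m. n div b ^ i mod b)"
proof -
  have "i < m" if "b ^ i \<le> n" for i
  proof -
    have "b ^ i < b ^ m" using that assms(2) by simp
    then show ?thesis using assms(1) by (simp add: power_strict_increasing_iff)
  qed
  then show ?thesis
    unfolding digit_sum_def by (intro sum.mono_neutral_left) auto
qed

lemma digit_sum_le:
  assumes "b \<ge> 2" and "n < b ^ m"
  shows "digit_sum b n \<le> m * (b - 1)"
proof -
  have "n div b ^ i mod b \<le> b - 1" for i
    using mod_less_divisor[of b "n div b ^ i"] assms(1) by linarith
  then show ?thesis
    using sum_bounded_above[of "{..<m}" "\<lambda>i. n div b ^ i mod b" "b - 1"]
    by (simp add: digit_sum_eq_sum[OF assms])
qed

text \<open>By Bernoulli's inequality, (m/(m+1))^p is at least 1 - p/(m+1), and the assumption makes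
  this at least 1/2.\<close>

lemma Suc_power_le_twice:
  fixes m p :: nat
  assumes "2 * p \<le> Suc m"
  shows "Suc m ^ p \<le> 2 * m ^ p"
proof -
  \<comment> \<open>Bernoulli's inequality for m/(m+1) = 1 - 1/(m+1), with denominators
    cleared.\<close>
  have "Suc m ^ q * (Suc m - q) \<le> Suc m * m ^ q" if "q \<le> Suc m" for q
    using that
  proof (induction q)
    case (Suc q)
    have "Suc m * (Suc m - Suc q) \<le> m * (Suc m - q)"
    proof -
      \<comment> \<open>The substitution removes the truncated subtractions; the two sides then
        differ by exactly \<open>q\<close>.\<close>
      obtain d where "m = q + d" using Suc.prems le_Suc_ex by auto
      then show ?thesis by (simp add: algebra_simps)
    qed
    then have "Suc m ^ Suc q * (Suc m - Suc q) \<le> m * (Suc m ^ q * (Suc m - q))"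
      using mult_left_mono[of "Suc m * (Suc m - Suc q)" "m * (Suc m - q)" "Suc m ^ q"]
      by (simp only: power_Suc mult_ac)
    also have "\<dots> \<le> m * (Suc m * m ^ q)"
      using Suc by (intro mult_left_mono) auto
    finally show ?case by (simp add: mult_ac)
  qed simp
  from this[of p] have bernoulli: "Suc m ^ p * (Suc m - p) \<le> Suc m * m ^ p"
    using assms by simp
  have "Suc m * Suc m ^ p \<le> (2 * (Suc m - p)) * Suc m ^ p"
    using assms by (intro mult_right_mono) auto
  also have "\<dots> \<le> Suc m * (2 * m ^ p)"
    using bernoulli by (simp add: mult_ac)
  finally show ?thesis by (simp only: mult_le_cancel1)
qed

text \<open>Each step from \<open>l\<close> to \<open>Suc l\<close> at most doubles the left-hand
  side, by \<open>Suc_power_le_twice\<close>, and multiplies the right-hand side by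
  \<open>b\<close>, which is at least 2.\<close>

lemma linear_power_less_power_mono:
  fixes b p k l :: nat
  assumes "b \<ge> 2" and "2 * p \<le> k + 2" and "(Suc k * c) ^ p < b ^ k" and "k \<le> l"
  shows "(Suc l * c) ^ p < b ^ l"
  using assms(4)
proof (induction l rule: dec_induct)
  case (step l)
  have "Suc (Suc l) ^ p \<le> 2 * Suc l ^ p"
    using assms(2) step.hyps by (intro Suc_power_le_twice) simp
  then have "(Suc (Suc l) * c) ^ p \<le> 2 * (Suc l * c) ^ p"
    unfolding power_mult_distrib using mult_right_mono[of _ _ "c ^ p"] by (metis mult.assoc zero_le)
  also have "\<dots> < 2 * b ^ l" using step.IH by simp
  also have "\<dots> \<le> b ^ Suc l" using assms(1) by simp
  finally show ?case .
qed (rule assms(3))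

lemma phi_fixpoint_less:
  assumes "b \<ge> 2" and "2 * p \<le> k + 2" and "(Suc k * (b - 1)) ^ p < b ^ k"
    and "phi b p n = n"
  shows "n < b ^ k"
proof (rule ccontr)
  assume "\<not> n < b ^ k"
  then have "b ^ k \<le> n" by simp
  then have "1 \<le> n" using assms(1) by (meson le_trans one_le_power one_le_numeral)
  \<comment> \<open>\<open>l\<close> is the position of the leading digit of
    \<open>n\<close>.\<close>
  then obtain l where l: "b ^ l \<le> n" "n < b ^ Suc l"
    using ex_power_ivl1[of b n] assms(1) by auto
  have "b ^ k < b ^ Suc l" using l(2) \<open>b ^ k \<le> n\<close> by simp
  then have "k < Suc l" using assms(1) by (simp only: power_strict_increasing_iff)
  then have "k \<le> l" by simp
  have "n = digit_sum b n ^ p" using assms(4) by (simp add: phi_def)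
  also have "\<dots> \<le> (Suc l * (b - 1)) ^ p"
    using digit_sum_le[OF assms(1) l(2)] by (rule power_mono) simp
  also have "\<dots> < b ^ l"
    using linear_power_less_power_mono[OF assms(1-3) \<open>k \<le> l\<close>] .
  finally show False using l(1) by simp
qed

text \<open>Since 2q \<le> q^2 for q \<ge> 2, a step at most doubles q^2 + 1, while b^q at least
  doubles.\<close>

lemma square_times_less_power_mono:
  fixes b p q :: nat
  assumes "b \<ge> 2" and "p \<ge> 2" and "Suc (p ^ 2) * c < b ^ p" and "p \<le> q"
  shows "Suc (q ^ 2) * c < b ^ q"
  using assms(4)
proof (induction q rule: dec_induct)
  case (step q)
  have "2 * q \<le> q ^ 2"
    unfolding power2_eq_square using assms(2) step.hyps by (intro mult_le_mono1) simp
  moreover have "Suc q ^ 2 = q ^ 2 + 2 * q + 1" by (simp add: power2_eq_square)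
  ultimately have "Suc (Suc q ^ 2) \<le> 2 * Suc (q ^ 2)" by presburger
  then have "Suc (Suc q ^ 2) * c \<le> 2 * (Suc (q ^ 2) * c)"
    using mult_right_mono[of _ _ c] by (metis mult.assoc zero_le)
  also have "\<dots> < 2 * b ^ q" using step.IH by simp
  also have "\<dots> \<le> b ^ Suc q" using assms(1) by simp
  finally show ?case .
qed (rule assms(3))

text \<open>This is the p-th root of the size condition of \<open>phi_fixpoint_less\<close> at k =
  p^2. It fails at each of the four excluded pairs, and the induction on \<open>p\<close> starts at
  the least exponent beyond them: 5 for b = 2, 3 for b = 3, and 2 otherwise.\<close>

lemma square_times_less_power:
  fixes b p :: nat
  assumes "b \<ge> 2" and "p \<ge> 2" and "(b, p) \<notin> {(2, 2), (2, 3), (2, 4), (3, 2)}"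
  shows "Suc (p ^ 2) * (b - 1) < b ^ p"
proof -
  consider "b = 2" "p \<ge> 5" | "b = 3" "p \<ge> 3" | "b \<ge> 4"
    using assms by force
  then show ?thesis
  proof cases
    case 1
    then show ?thesis
      using square_times_less_power_mono[of b 5 "b - 1" p] by simp
  next
    case 2
    then show ?thesis
      using square_times_less_power_mono[of b 3 "b - 1" p] by simp
  next
    case 3
    then obtain d where "b = 4 + d" using le_Suc_ex by blast
    then have "Suc (2 ^ 2) * (b - 1) < b ^ 2"
      by (simp add: power2_eq_square algebra_simps)
    then show ?thesis
      using square_times_less_power_mono[of b 2 "b - 1" p] assms by simp
  qed
qed

lemma phi_fixpoint_le_exceptional:
  assumes "(b, p) \<in> {(2, 2), (2, 3), (2, 4), (3, 2)}" and fixpoint: "phi b p n = n"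
  shows "n \<le> b ^ (p ^ 2)"
proof (rule ccontr)
  assume "\<not> n \<le> b ^ (p ^ 2)"
  then have gt: "b ^ (p ^ 2) < n" by simp
  define s where "s = digit_sum b n"
  have n: "n = s ^ p" using fixpoint by (simp add: phi_def s_def)
  have sum_eq: "digit_sum b (s ^ p) = s" using n s_def by metis
  \<comment> \<open>Below, \<open>x\<close> is b^p, \<open>m\<close> is the least \<open>k\<close>
    that satisfies the size condition of \<open>phi_fixpoint_less\<close>, and \<open>y\<close> is
    the least base with b^m \<le> y^p. Few candidates for \<open>s\<close> remain.\<close>
  have range: "x < s \<and> s < y" if "x ^ p \<le> b ^ (p ^ 2)" "n < b ^ m" "b ^ m \<le> y ^ p" for x y m
  proof -
    have "x ^ p < s ^ p" "s ^ p < y ^ p" using that gt n by simp_all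
    then show ?thesis by (meson power_less_imp_less_base zero_le)
  qed
  consider "b = 2" "p = 2" | "b = 2" "p = 3" | "b = 2" "p = 4" | "b = 3" "p = 2"
    using assms(1) by auto
  then show False
  proof cases
    case 1
    have "n < 2 ^ 6"
      using phi_fixpoint_less[of 2 2 6 n] fixpoint 1 by simp
    then have "digit_sum 2 (s ^ 2) = s \<and> 4 < s \<and> s < 8"
      using range[of 4 6 8] sum_eq 1 by simp
    moreover from this have "s \<in> {5, 6, 7}" by auto
    ultimately show False
      by (auto simp: digit_sum_eq_sum[of 2 _ 6] lessThan_nat_numeral)
  next
    case 2
    have "n < 2 ^ 11"
      using phi_fixpoint_less[of 2 3 11 n] fixpoint 2 by simp
    then have "digit_sum 2 (s ^ 3) = s \<and> 8 < s \<and> s < 13"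
      using range[of 8 11 13] sum_eq 2 by simp
    moreover from this have "s \<in> {9, 10, 11, 12}" by auto
    ultimately show False
      by (auto simp: digit_sum_eq_sum[of 2 _ 11] lessThan_nat_numeral)
  next
    case 3
    have "n < 2 ^ 17"
      using phi_fixpoint_less[of 2 4 17 n] fixpoint 3 by simp
    then have "digit_sum 2 (s ^ 4) = s \<and> 16 < s \<and> s < 20"
      using range[of 16 17 20] sum_eq 3 by simp
    moreover from this have "s \<in> {17, 18, 19}" by auto
    ultimately show False
      by (auto simp: digit_sum_eq_sum[of 2 _ 17] lessThan_nat_numeral)
  next
    case 4
    have "n < 3 ^ 5"
      using phi_fixpoint_less[of 3 2 5 n] fixpoint 4 by simp
    then have "digit_sum 3 (s ^ 2) = s \<and> 9 < s \<and> s < 16"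
      using range[of 9 5 16] sum_eq 4 by simp
    moreover from this have "s \<in> {10, 11, 12, 13, 14, 15}" by auto
    ultimately show False
      by (auto simp: digit_sum_eq_sum[of 3 _ 5] lessThan_nat_numeral)
  qed
qed

theorem theorem6p1:
  fixes b p :: nat
  assumes "b \<ge> 2" and "p \<ge> 2"
  shows "finite {n. phi b p n = n} \<and> (\<forall>n. phi b p n = n \<longrightarrow> n \<le> b ^ (p ^ 2))"
proof -
  have bound: "n \<le> b ^ (p ^ 2)" if fixpoint: "phi b p n = n" for n
  proof (cases "(b, p) \<in> {(2, 2), (2, 3), (2, 4), (3, 2)}")
    case True
    then show ?thesis using fixpoint by (rule phi_fixpoint_le_exceptional)
  next
    case False
    \<comment> \<open>Because b^(p^2) = (b^p)^p, taking p-th powers yields the condition of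
      \<open>phi_fixpoint_less\<close> at k = p^2.\<close>
    then have "(Suc (p ^ 2) * (b - 1)) ^ p < (b ^ p) ^ p"
      using square_times_less_power[OF assms] assms(2) by (intro power_strict_mono) auto
    then have "(Suc (p ^ 2) * (b - 1)) ^ p < b ^ (p ^ 2)"
      by (simp only: power_mult power2_eq_square)
    moreover have "2 * p \<le> p ^ 2 + 2"
      using mult_right_mono[OF assms(2), of p] unfolding power2_eq_square by linarith
    ultimately show ?thesis
      using phi_fixpoint_less[OF assms(1) _ _ fixpoint] by (simp add: less_imp_le)
  qed
  then have "{n. phi b p n = n} \<subseteq> {..b ^ (p ^ 2)}" by auto
  then show ?thesis using bound finite_subset by blast
qed

end
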